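(* Let $n,d\ge1$. For $k\ge1$ let $\mathbf M_k\in\mathbb R^{n\times n}$ be invertible; for $k\ge0$ let $\mathbf H_k\in\mathbb R^{d\times n}$, $\mathbf R_k$ symmetric positive definite, ${\boldsymbol\Omega}_k=\mathbf H_k^{\mathrm T}\mathbf R_k^{-1}\mathbf H_k$. Let $\mathbf M_{k:0}=\mathbf M_k\cdots\mathbf M_1$ ($\mathbf M_{0:0}=\mathbf I_n$), let $\mathbf P_0$ be symmetric positive semi-definite and $\mathbf P_{k+1}=\mathbf M_{k+1}(\mathbf I_n+\mathbf P_k{\boldsymbol\Omega}_k)^{-1}\mathbf P_k\mathbf M_{k+1}^{\mathrm T}$ for $k\ge0$. Then for every $k\ge0$, $\mathrm{rank}(\mathbf P_{k+1})=\mathrm{rank}(\mathbf P_k)$ and $$\mathrm{Im}(\mathbf P_k)=\mathbf M_{k:0}\big(\mathrm{Im}(\mathbf P_0)\big),$$ where $\mathrm{Im}(\mathbf A)=\{\mathbf A{\mathbf x}:{\mathbf x}\in\mathbb R^n\}$ is the column space. *)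

theory Defs
  imports "HOL-Analysis.Analysis"
begin

definition sym_psd :: "real^'n^'n \<Rightarrow> bool" where
  "sym_psd A \<longleftrightarrow> transpose A = A \<and> (\<forall>x. 0 \<le> x \<bullet> (A *v x))"

definition sym_pd :: "real^'n^'n \<Rightarrow> bool" where
  "sym_pd A \<longleftrightarrow> transpose A = A \<and> (\<forall>x. x \<noteq> 0 \<longrightarrow> 0 < x \<bullet> (A *v x))"

text \<open>Column space Im(A) = {A x : x}.\<close>
definition col_space :: "real^'n^'m \<Rightarrow> (real^'m) set" where
  "col_space A = range (\<lambda>x. A *v x)"

text \<open>M_{k:0} = M_k ** ... ** M_1, with M_{0:0} = I.\<close>
fun Mprod :: "(nat \<Rightarrow> real^'n^'n) \<Rightarrow> nat \<Rightarrow> real^'n^'n" where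
  "Mprod M 0 = mat 1"
| "Mprod M (Suc k) = M (Suc k) ** Mprod M k"

end

theory Submission
  imports Defs
begin

text \<open>By the push-through identity \<open>(I + P \<Omega>)\<^sup>-\<^sup>1 P = P (I + \<Omega> P)\<^sup>-\<^sup>1\<close>, the update
\<open>P\<^sub>k\<^sub>+\<^sub>1 = M (I + P\<^sub>k \<Omega>)\<^sup>-\<^sup>1 P\<^sub>k M\<^sup>T\<close> multiplies \<open>P\<^sub>k\<close> on the right by an invertible matrix and on
the left by \<open>M\<close>, so \<open>Im P\<^sub>k\<^sub>+\<^sub>1 = M Im P\<^sub>k\<close>; these compose to \<open>M\<^sub>k\<^sub>:\<^sub>0 Im P\<^sub>0\<close>, and the injective
\<open>M\<close> preserves the dimension. The invertibility of \<open>I + P \<Omega>\<close> uses that \<open>P\<close> is positive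
semi-definite as a quadratic form, and this persists along the recursion: with \<open>z = u + \<Omega> P u\<close>
one gets \<open>z\<^sup>T (I + P \<Omega>)\<^sup>-\<^sup>1 P z = u\<^sup>T P u + (P u)\<^sup>T \<Omega> (P u) \<ge> 0\<close>.\<close>

definition nonneg_form :: "real^'n^'n \<Rightarrow> bool" where
  "nonneg_form A \<longleftrightarrow> (\<forall>x. 0 \<le> x \<bullet> (A *v x))"

definition pos_form :: "real^'n^'n \<Rightarrow> bool" where
  "pos_form A \<longleftrightarrow> (\<forall>x. x \<noteq> 0 \<longrightarrow> 0 < x \<bullet> (A *v x))"

definition riccati_step :: "real^'n^'n \<Rightarrow> real^'n^'n \<Rightarrow> real^'n^'n \<Rightarrow> real^'n^'n" where
  "riccati_step M \<Omega> P = M ** matrix_inv (mat 1 + P ** \<Omega>) ** P ** transpose M"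

lemma
  fixes A :: "'a::semiring_1^'n^'m"
  assumes "invertible A"
  shows matrix_inv_right: "A ** matrix_inv A = mat 1"
    and matrix_inv_left: "matrix_inv A ** A = mat 1"
proof -
  have "\<exists>A'. A ** A' = mat 1 \<and> A' ** A = mat 1"
    using assms unfolding invertible_def by blast
  then have "A ** matrix_inv A = mat 1 \<and> matrix_inv A ** A = mat 1"
    unfolding matrix_inv_def by (rule someI_ex)
  then show "A ** matrix_inv A = mat 1" "matrix_inv A ** A = mat 1" by auto
qed

lemma invertible_matrix_inv:
  fixes A :: "'a::semiring_1^'n^'m"
  assumes "invertible A"
  shows "invertible (matrix_inv A)"
  using matrix_inv_left[OF assms] matrix_inv_right[OF assms] unfolding invertible_def by blast

lemma invertibleI_ker:
  fixes A :: "'a::field^'n^'n"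
  assumes "\<And>x. A *v x = 0 \<Longrightarrow> x = 0"
  shows "invertible A"
  using assms invertible_left_inverse matrix_left_invertible_ker by blast

lemma quadratic_form_congruence:
  fixes B :: "real^'n^'m" and C :: "real^'m^'m"
  shows "x \<bullet> ((transpose B ** C ** B) *v x) = (B *v x) \<bullet> (C *v (B *v x))"
proof -
  have "x \<bullet> (transpose B *v w) = (B *v x) \<bullet> w" for w
    using dot_lmul_matrix[of x "transpose B" w] by simp
  then show ?thesis by (simp flip: matrix_vector_mul_assoc)
qed

lemma nonneg_form_congruence:
  fixes B :: "real^'n^'m"
  assumes "nonneg_form C"
  shows "nonneg_form (transpose B ** C ** B)"
  using assms unfolding nonneg_form_def quadratic_form_congruence by blast

lemma pos_form_imp_nonneg_form:
  fixes A :: "real^'n^'n"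
  assumes "pos_form A"
  shows "nonneg_form A"
  unfolding nonneg_form_def
proof
  fix x :: "real^'n"
  show "0 \<le> x \<bullet> (A *v x)"
    using assms unfolding pos_form_def by (cases "x = 0") (simp_all add: less_imp_le)
qed

lemma sym_pd_imp_pos_form: "sym_pd A \<Longrightarrow> pos_form A"
  unfolding sym_pd_def pos_form_def by blast

lemma pos_form_invertible:
  assumes "pos_form A"
  shows "invertible A"
proof (rule invertibleI_ker)
  fix x assume "A *v x = 0"
  then show "x = 0" using assms unfolding pos_form_def by force
qed

lemma pos_form_matrix_inv:
  fixes A :: "real^'n^'n"
  assumes "pos_form A"
  shows "pos_form (matrix_inv A)"
  unfolding pos_form_def
proof (intro allI impI)
  fix y :: "real^'n" assume "y \<noteq> 0"
  define u where "u = matrix_inv A *v y"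
  have y: "y = A *v u"
    using matrix_inv_right[OF pos_form_invertible[OF assms]]
    by (simp add: u_def matrix_vector_mul_assoc)
  with \<open>y \<noteq> 0\<close> have "u \<noteq> 0" by auto
  then have "0 < u \<bullet> (A *v u)" using assms unfolding pos_form_def by blast
  moreover have "y \<bullet> (matrix_inv A *v y) = (A *v u) \<bullet> u"
    by (simp add: u_def[symmetric] flip: y)
  ultimately show "0 < y \<bullet> (matrix_inv A *v y)"
    by (simp add: inner_commute)
qed

lemma gram_form_zero:
  fixes H :: "real^'n^'m"
  assumes "pos_form Q" and "x \<bullet> ((transpose H ** Q ** H) *v x) = 0"
  shows "(transpose H ** Q ** H) *v x = 0"
proof -
  have "(H *v x) \<bullet> (Q *v (H *v x)) = 0"
    using assms(2) by (simp only: quadratic_form_congruence)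
  then have "H *v x = 0"
    using assms(1) unfolding pos_form_def by (metis less_irrefl)
  then show ?thesis by (simp flip: matrix_vector_mul_assoc)
qed

lemma invertible_one_plus_mult_gram:
  fixes H :: "real^'n^'m"
  assumes "nonneg_form P" and "pos_form Q"
  shows "invertible (mat 1 + P ** (transpose H ** Q ** H))" (is "invertible (mat 1 + P ** ?\<Omega>)")
proof (rule invertibleI_ker)
  fix x assume "(mat 1 + P ** ?\<Omega>) *v x = 0"
  then have x: "x = - (P *v (?\<Omega> *v x))"
    by (simp add: matrix_vector_mult_add_rdistrib eq_neg_iff_add_eq_0 flip: matrix_vector_mul_assoc)
  have "0 \<le> x \<bullet> (?\<Omega> *v x)"
    using nonneg_form_congruence pos_form_imp_nonneg_form assms(2) unfolding nonneg_form_def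
    by blast
  moreover have "x \<bullet> (?\<Omega> *v x) = - ((?\<Omega> *v x) \<bullet> (P *v (?\<Omega> *v x)))"
    by (subst x) (simp add: inner_commute)
  moreover have "0 \<le> (?\<Omega> *v x) \<bullet> (P *v (?\<Omega> *v x))"
    using assms(1) unfolding nonneg_form_def by blast
  ultimately have "x \<bullet> (?\<Omega> *v x) = 0" by linarith
  then have "?\<Omega> *v x = 0" using assms(2) by (rule gram_form_zero[rotated])
  with x show "x = 0" by simp
qed

lemma invertible_one_plus_mult_commute:
  fixes A B :: "real^'n^'n"
  assumes "invertible (mat 1 + A ** B)"
  shows "invertible (mat 1 + B ** A)"
proof (rule invertibleI_ker)
  fix y assume y: "(mat 1 + B ** A) *v y = 0"
  have "(mat 1 + A ** B) *v (A *v y) = A *v ((mat 1 + B ** A) *v y)"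
    by (simp add: matrix_vector_mult_add_rdistrib matrix_vector_right_distrib
        flip: matrix_vector_mul_assoc)
  with y have "(mat 1 + A ** B) *v (A *v y) = 0" by simp
  then have "A *v y = 0"
    using inj_matrix_vector_mult[OF assms] by (metis injD matrix_vector_mult_0_right)
  with y show "y = 0"
    by (simp add: matrix_vector_mult_add_rdistrib flip: matrix_vector_mul_assoc)
qed

lemma matrix_inv_push_through:
  fixes A B :: "real^'n^'n"
  assumes "invertible (mat 1 + A ** B)"
  shows "matrix_inv (mat 1 + A ** B) ** A = A ** matrix_inv (mat 1 + B ** A)"
proof -
  let ?L = "mat 1 + A ** B" and ?R = "mat 1 + B ** A"
  have comm: "?L ** A = A ** ?R"
    by (simp add: matrix_add_ldistrib matrix_mul_assoc matrix_eq matrix_vector_mult_add_rdistrib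
        flip: matrix_vector_mul_assoc)
  have "matrix_inv ?L ** A = matrix_inv ?L ** A ** (?R ** matrix_inv ?R)"
    using matrix_inv_right[OF invertible_one_plus_mult_commute[OF assms]] by simp
  also have "\<dots> = matrix_inv ?L ** (A ** ?R) ** matrix_inv ?R"
    by (simp only: matrix_mul_assoc)
  also have "\<dots> = (matrix_inv ?L ** ?L) ** A ** matrix_inv ?R"
    by (simp only: comm[symmetric] matrix_mul_assoc)
  also have "\<dots> = A ** matrix_inv ?R"
    by (simp add: matrix_inv_left[OF assms])
  finally show ?thesis .
qed

lemma nonneg_form_matrix_inv_one_plus_mult:
  fixes P \<Omega> :: "real^'n^'n"
  assumes P: "nonneg_form P" and \<Omega>: "nonneg_form \<Omega>" and inv: "invertible (mat 1 + P ** \<Omega>)"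
  shows "nonneg_form (matrix_inv (mat 1 + P ** \<Omega>) ** P)"
  unfolding nonneg_form_def
proof
  fix z :: "real^'n"
  let ?R = "mat 1 + \<Omega> ** P"
  define u where "u = matrix_inv ?R *v z"
  have z: "z = u + \<Omega> *v (P *v u)"
  proof -
    have "z = (?R ** matrix_inv ?R) *v z"
      using matrix_inv_right[OF invertible_one_plus_mult_commute[OF inv]] by simp
    also have "\<dots> = u + \<Omega> *v (P *v u)"
      by (simp add: u_def matrix_vector_mult_add_rdistrib flip: matrix_vector_mul_assoc)
    finally show ?thesis .
  qed
  have "z \<bullet> ((matrix_inv (mat 1 + P ** \<Omega>) ** P) *v z) = z \<bullet> (P *v u)"
    by (simp add: matrix_inv_push_through[OF inv] u_def flip: matrix_vector_mul_assoc)
  also have "\<dots> = (u + \<Omega> *v (P *v u)) \<bullet> (P *v u)"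
    by (simp only: flip: z)
  also have "\<dots> = u \<bullet> (P *v u) + (\<Omega> *v (P *v u)) \<bullet> (P *v u)"
    by (simp add: inner_add_left)
  moreover have "0 \<le> u \<bullet> (P *v u)" and "0 \<le> (\<Omega> *v (P *v u)) \<bullet> (P *v u)"
    using P \<Omega> unfolding nonneg_form_def by (simp_all add: inner_commute)
  ultimately show "0 \<le> z \<bullet> ((matrix_inv (mat 1 + P ** \<Omega>) ** P) *v z)"
    by simp
qed

lemma nonneg_form_riccati_step:
  assumes "nonneg_form P" and "nonneg_form \<Omega>" and "invertible (mat 1 + P ** \<Omega>)"
  shows "nonneg_form (riccati_step M \<Omega> P)"
  using nonneg_form_congruence[OF nonneg_form_matrix_inv_one_plus_mult[OF assms],
      of "transpose M"]
  by (simp add: riccati_step_def matrix_mul_assoc)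

lemma col_space_mult_left:
  fixes A :: "real^'m^'k" and B :: "real^'n^'m"
  shows "col_space (A ** B) = (*v) A ` col_space B"
  unfolding col_space_def by (auto simp: image_image matrix_vector_mul_assoc)

lemma col_space_mult_invertible_right:
  fixes A :: "real^'n^'m" and B :: "real^'n^'n"
  assumes "invertible B"
  shows "col_space (A ** B) = col_space A"
proof -
  have "surj ((*v) B)"
    using matrix_inv_right[OF assms] matrix_right_invertible_surjective by blast
  then show ?thesis
    by (metis col_space_def col_space_mult_left)
qed

lemma col_space_riccati_step:
  assumes M: "invertible M" and inv: "invertible (mat 1 + P ** \<Omega>)"
  shows "col_space (riccati_step M \<Omega> P) = (*v) M ` col_space P"
proof -
  have right_factor: "invertible (matrix_inv (mat 1 + \<Omega> ** P) ** transpose M)"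
    using invertible_matrix_inv[OF invertible_one_plus_mult_commute[OF inv]]
      transpose_invertible[OF M] by (rule invertible_mult)
  have "riccati_step M \<Omega> P = M ** (matrix_inv (mat 1 + P ** \<Omega>) ** P) ** transpose M"
    by (simp only: riccati_step_def matrix_mul_assoc)
  also have "\<dots> = M ** (P ** (matrix_inv (mat 1 + \<Omega> ** P) ** transpose M))"
    by (simp only: matrix_inv_push_through[OF inv] matrix_mul_assoc)
  finally show ?thesis
    by (simp only: col_space_mult_left[of M] col_space_mult_invertible_right[OF right_factor])
qed

lemma rank_eq_if_col_space_image:
  fixes A B M :: "real^'n^'n"
  assumes "invertible M" and "col_space B = (*v) M ` col_space A"
  shows "rank B = rank A"
proof -
  have "inj_on ((*v) M) (span (col_space A))"
    using inj_matrix_vector_mult[OF assms(1)] by (metis inj_on_subset subset_UNIV)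
  then have "dim ((*v) M ` col_space A) = dim (col_space A)"
    by (rule eucl.dim_image_eq[OF matrix_vector_mul_linear])
  then show ?thesis
    using assms(2) by (simp add: rank_dim_range col_space_def)
qed

theorem mainTheorem4:
  fixes M :: "nat \<Rightarrow> real^'n^'n"
    and H :: "nat \<Rightarrow> real^'n^'d"
    and R :: "nat \<Rightarrow> real^'d^'d"
    and \<Omega> :: "nat \<Rightarrow> real^'n^'n"
    and P :: "nat \<Rightarrow> real^'n^'n"
  assumes M_inv: "\<And>k. k \<ge> 1 \<Longrightarrow> invertible (M k)"
    and R_pd: "\<And>k. sym_pd (R k)"
    and \<Omega>_def: "\<And>k. \<Omega> k = transpose (H k) ** matrix_inv (R k) ** H k"
    and P0: "sym_psd (P 0)"
    and P_rec: "\<And>k. P (Suc k) =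
        M (Suc k) ** matrix_inv (mat 1 + P k ** \<Omega> k) ** P k ** transpose (M (Suc k))"
  shows "\<forall>k. rank (P (Suc k)) = rank (P k) \<and>
             col_space (P k) = (\<lambda>x. Mprod M k *v x) ` col_space (P 0)"
proof -
  have M_Suc: "invertible (M (Suc k))" for k
    using M_inv by simp
  have R_inv_pos: "pos_form (matrix_inv (R k))" for k
    using sym_pd_imp_pos_form[OF R_pd] by (rule pos_form_matrix_inv)
  have \<Omega>_nonneg: "nonneg_form (\<Omega> k)" for k
    unfolding \<Omega>_def using pos_form_imp_nonneg_form[OF R_inv_pos] by (rule nonneg_form_congruence)
  have update_invertible: "invertible (mat 1 + P k ** \<Omega> k)" if "nonneg_form (P k)" for k
    unfolding \<Omega>_def using that R_inv_pos by (rule invertible_one_plus_mult_gram)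
  have step: "P (Suc k) = riccati_step (M (Suc k)) (\<Omega> k) (P k)" for k
    by (simp add: P_rec riccati_step_def)
  have P_nonneg: "nonneg_form (P k)" for k
  proof (induction k)
    case 0
    then show ?case using P0 by (simp add: sym_psd_def nonneg_form_def)
  next
    case (Suc k)
    then show ?case
      unfolding step using \<Omega>_nonneg update_invertible[OF Suc] by (rule nonneg_form_riccati_step)
  qed
  have col_step: "col_space (P (Suc k)) = (*v) (M (Suc k)) ` col_space (P k)" for k
    unfolding step by (rule col_space_riccati_step[OF M_Suc update_invertible[OF P_nonneg]])
  have "col_space (P k) = (\<lambda>x. Mprod M k *v x) ` col_space (P 0)" for k
    by (induction k) (simp_all add: col_step image_image matrix_vector_mul_assoc)
  moreover have "rank (P (Suc k)) = rank (P k)" for k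
    by (rule rank_eq_if_col_space_image[OF M_Suc col_step])
  ultimately show ?thesis by blast
qed

end
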